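(* Let $r>1$ and let $U=(u_{ij})_{i,j\in\mathbb{Z}}$ be a matrix of $r\times r$ blocks depending on $\boldsymbol{x}=(x_0,x_1,\ldots)$ and $\boldsymbol{y}=(y_0,y_1,\ldots)$ that satisfies, for all $i,j\in\mathbb{Z}$ and $k=1,2,\ldots$, $$\frac{\partial u_{ij}}{\partial x_k}=\frac{\partial u_{i+1,j}}{\partial x_{k-1}}-u_{i0}\frac{\partial u_{0j}}{\partial x_{k-1}},\qquad \frac{\partial u_{ij}}{\partial y_k}=\frac{\partial u_{i+1,j}}{\partial y_{k-1}}-u_{i0}\frac{\partial u_{0j}}{\partial y_{k-1}},$$ together with the constraint $u_{i+1,j}-u_{i,j+1}-u_{i0}u_{0j}=0$ for all $i,j\in\mathbb{Z}$. Let $\rho(z)$ be a $\mathrm{GL}(r)$-valued function of $z,\boldsymbol{x},\boldsymbol{y}$ satisfying $$\frac{\partial\rho(z)}{\partial x_k}-z\frac{\partial\rho(z)}{\partial x_{k-1}}=0,\qquad \frac{\partial\rho(z)}{\partial y_k}-z\frac{\partial\rho(z)}{\partial y_{k-1}}=0,\qquad k=1,2,\ldots,$$ and let $$u_0(z)=\Bigl(E_r-\sum_{j=0}^\infty u_{0j}z^{-j-1}\Bigr)\rho(z),\qquad \bar u_0(z)=\Bigl(E_r+\sum_{j=0}^\infty u_{0,-j-1}z^{j}\Bigr)\rho(z).$$ Then for $k=1,2,\ldots$ $$\frac{\partial u_0(z)}{\partial x_k}=z\frac{\partial u_0(z)}{\partial x_{k-1}}+\frac{\partial u_{00}}{\partial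 x_{k-1}}u_0(z),\qquad \frac{\partial u_0(z)}{\partial y_k}=z\frac{\partial u_0(z)}{\partial y_{k-1}}+\frac{\partial u_{00}}{\partial y_{k-1}}u_0(z),$$ $$\frac{\partial\bar u_0(z)}{\partial x_k}=z\frac{\partial\bar u_0(z)}{\partial x_{k-1}}+\frac{\partial u_{00}}{\partial x_{k-1}}\bar u_0(z),\qquad \frac{\partial\bar u_0(z)}{\partial y_k}=z\frac{\partial\bar u_0(z)}{\partial y_{k-1}}+\frac{\partial u_{00}}{\partial y_{k-1}}\bar u_0(z).$$
   Context: $E_r$ is the $r\times r$ unit matrix. The wave functions are formal Laurent series in $z$ with $r\times r$ matrix coefficients times the right factor $\rho(z)$, differentiated by the Leibniz rule; the equations are the auxiliary linear equations of the anti-self-dual Yang–Mills (ASDYM) hierarchy. *)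

theory Defs
  imports "HOL-Analysis.Analysis" "HOL-Library.Multiset"
begin

section \<open>Functions of the variables x and y\<close>

type_synonym 'a point = "(nat \<Rightarrow> 'a) \<times> (nat \<Rightarrow> 'a)"

type_synonym ('a, 'r) mat_fun = "'a point \<Rightarrow> 'a ^ 'r ^ 'r"

datatype var = Var_x nat | Var_y nat

fun coord :: "var \<Rightarrow> 'a point \<Rightarrow> 'a" where
  "coord (Var_x k) (x, y) = x k"
| "coord (Var_y k) (x, y) = y k"

fun set_coord :: "var \<Rightarrow> 'a \<Rightarrow> 'a point \<Rightarrow> 'a point" where
  "set_coord (Var_x k) t (x, y) = (x(k := t), y)"
| "set_coord (Var_y k) t (x, y) = (x, y(k := t))"

text \<open>Openness in each coordinate separately is all that partial derivatives need. It is weaker than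
  openness in the product topology, which would leave almost all variables unrestricted and so would
  exclude domains of convergence of solutions that depend on infinitely many variables.\<close>

definition coord_open :: "'a::topological_space point set \<Rightarrow> bool" where
  "coord_open D \<longleftrightarrow> (\<forall>p\<in>D. \<forall>v. \<forall>\<^sub>F t in nhds (coord v p). set_coord v t p \<in> D)"

definition has_partial :: "var \<Rightarrow> ('a::real_normed_field, 'r::finite) mat_fun \<Rightarrow> 'a point \<Rightarrow> bool" where
  "has_partial v f p \<longleftrightarrow>
     (\<forall>i j. (\<lambda>t. f (set_coord v t p) $ i $ j) field_differentiable at (coord v p))"

definition partial :: "var \<Rightarrow> ('a::real_normed_field, 'r::finite) mat_fun \<Rightarrow> ('a, 'r) mat_fun" where
  "partial v f p = (\<chi> i j. deriv (\<lambda>t. f (set_coord v t p) $ i $ j) (coord v p))"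

text \<open>All iterated partial derivatives exist on \<open>D\<close>.\<close>

definition smooth :: "'a::real_normed_field point set \<Rightarrow> ('a, 'r::finite) mat_fun \<Rightarrow> bool" where
  "smooth D f \<longleftrightarrow> (\<forall>vs v. \<forall>p\<in>D. has_partial v (foldr partial vs f) p)"

section \<open>Formal Laurent series in z\<close>

text \<open>\<open>W n\<close> is the coefficient of \<open>z\<^sup>n\<close>. A series with infinitely many negative powers and one with
  infinitely many positive powers belong to two different spaces.\<close>

type_synonym ('a, 'r) laurent = "int \<Rightarrow> ('a, 'r) mat_fun"

definition laurent_neg :: "'a::real_normed_field point set \<Rightarrow> ('a, 'r::finite) laurent set" where
  "laurent_neg D = {W. (\<forall>n. smooth D (W n)) \<and> (\<exists>N. \<forall>n>N. \<forall>p\<in>D. W n p = 0)}"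

definition laurent_pos :: "'a::real_normed_field point set \<Rightarrow> ('a, 'r::finite) laurent set" where
  "laurent_pos D = {W. (\<forall>n. smooth D (W n)) \<and> (\<exists>N. \<forall>n<N. \<forall>p\<in>D. W n p = 0)}"

definition laurent_partial ::
    "var \<Rightarrow> ('a::real_normed_field, 'r::finite) laurent \<Rightarrow> ('a, 'r) laurent" where
  "laurent_partial v W = (\<lambda>n. partial v (W n))"

definition laurent_z :: "('a, 'r) laurent \<Rightarrow> ('a, 'r) laurent" where
  "laurent_z W = (\<lambda>n. W (n - 1))"

definition laurent_left ::
    "('a::semiring_1, 'r::finite) mat_fun \<Rightarrow> ('a, 'r) laurent \<Rightarrow> ('a, 'r) laurent" where
  "laurent_left A W = (\<lambda>n p. A p ** W n p)"

definition laurent_right ::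
    "('a::semiring_1, 'r::finite) laurent \<Rightarrow> ('a, 'r) mat_fun \<Rightarrow> ('a, 'r) laurent" where
  "laurent_right W A = (\<lambda>n p. W n p ** A p)"

section \<open>Formal Laurent series times matrix functions of z, x, y\<close>

type_synonym ('a, 'r) z_fun = "'a \<Rightarrow> ('a, 'r) mat_fun"

definition smooth_z_fun ::
    "'a::real_normed_field set \<Rightarrow> 'a point set \<Rightarrow> ('a, 'r::finite) z_fun set" where
  "smooth_z_fun Z D = {f. \<forall>z\<in>Z. smooth D (f z)}"

text \<open>The series is formal while its right factor is a genuine function of \<open>z\<close>, so their product is a
  formal one. A wave expression is a finite formal sum of products \<open>W \<cdot> f\<close>, each represented by the
  pair \<open>(W, f)\<close>.\<close>

type_synonym ('a, 'r) wave = "(('a, 'r) laurent \<times> ('a, 'r) z_fun) multiset"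

text \<open>Equality of wave expressions is equality in the tensor product of the space \<open>L\<close> of series and
  the space of matrix functions on \<open>Z \<times> D\<close>, over the polynomials in \<open>z\<close> whose coefficients are
  matrix functions of \<open>x\<close> and \<open>y\<close>: it is generated by biadditivity and by moving \<open>z\<close> and such
  matrix functions across the product. Factors that agree on the domain are identified. Additive
  inverses exist because \<open>(- W, f)\<close> cancels \<open>(W, f)\<close>.\<close>

inductive wave_eq ::
    "('a::real_normed_field, 'r::finite) laurent set \<Rightarrow> 'a set \<Rightarrow> 'a point set \<Rightarrow>
     ('a, 'r) wave \<Rightarrow> ('a, 'r) wave \<Rightarrow> bool"
  for L Z D where
  refl: "wave_eq L Z D P P"
| sym: "wave_eq L Z D P Q \<Longrightarrow> wave_eq L Z D Q P"
| trans: "wave_eq L Z D P Q \<Longrightarrow> wave_eq L Z D Q R \<Longrightarrow> wave_eq L Z D P R"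
| add: "wave_eq L Z D P Q \<Longrightarrow> wave_eq L Z D (P + R) (Q + R)"
| zero: "f \<in> smooth_z_fun Z D \<Longrightarrow> wave_eq L Z D {#(\<lambda>n p. 0, f)#} {#}"
| add_left: "W \<in> L \<Longrightarrow> W' \<in> L \<Longrightarrow> f \<in> smooth_z_fun Z D \<Longrightarrow>
    wave_eq L Z D {#(\<lambda>n p. W n p + W' n p, f)#} {#(W, f), (W', f)#}"
| add_right: "W \<in> L \<Longrightarrow> f \<in> smooth_z_fun Z D \<Longrightarrow> f' \<in> smooth_z_fun Z D \<Longrightarrow>
    wave_eq L Z D {#(W, \<lambda>z p. f z p + f' z p)#} {#(W, f), (W, f')#}"
| move_z: "W \<in> L \<Longrightarrow> f \<in> smooth_z_fun Z D \<Longrightarrow>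
    wave_eq L Z D {#(laurent_z W, f)#} {#(W, \<lambda>z p. mat z ** f z p)#}"
| move_mat: "W \<in> L \<Longrightarrow> smooth D A \<Longrightarrow> f \<in> smooth_z_fun Z D \<Longrightarrow>
    wave_eq L Z D {#(laurent_right W A, f)#} {#(W, \<lambda>z p. A p ** f z p)#}"
| agree: "W \<in> L \<Longrightarrow> W' \<in> L \<Longrightarrow> f \<in> smooth_z_fun Z D \<Longrightarrow> f' \<in> smooth_z_fun Z D \<Longrightarrow>
    (\<And>n p. p \<in> D \<Longrightarrow> W n p = W' n p) \<Longrightarrow>
    (\<And>z p. z \<in> Z \<Longrightarrow> p \<in> D \<Longrightarrow> f z p = f' z p) \<Longrightarrow>
    wave_eq L Z D {#(W, f)#} {#(W', f')#}"

text \<open>The Leibniz rule. Because all factors are smooth, it is compatible with \<open>wave_eq\<close> on a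
  \<open>coord_open\<close> domain.\<close>

definition wave_partial ::
    "var \<Rightarrow> ('a::real_normed_field, 'r::finite) wave \<Rightarrow> ('a, 'r) wave" where
  "wave_partial v P = image_mset (\<lambda>(W, f). (laurent_partial v W, f)) P
                    + image_mset (\<lambda>(W, f). (W, \<lambda>z. partial v (f z))) P"

definition wave_z :: "('a, 'r) wave \<Rightarrow> ('a, 'r) wave" where
  "wave_z P = image_mset (\<lambda>(W, f). (laurent_z W, f)) P"

definition wave_left ::
    "('a::semiring_1, 'r::finite) mat_fun \<Rightarrow> ('a, 'r) wave \<Rightarrow> ('a, 'r) wave" where
  "wave_left A P = image_mset (\<lambda>(W, f). (laurent_left A W, f)) P"

section \<open>The wave functions\<close>

definition u0_series ::
    "(int \<Rightarrow> int \<Rightarrow> ('a::comm_ring_1, 'r::finite) mat_fun) \<Rightarrow> ('a, 'r) laurent" where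
  "u0_series u = (\<lambda>n p. if n < 0 then - u 0 (- n - 1) p else if n = 0 then mat 1 else 0)"

definition ubar0_series ::
    "(int \<Rightarrow> int \<Rightarrow> ('a::comm_ring_1, 'r::finite) mat_fun) \<Rightarrow> ('a, 'r) laurent" where
  "ubar0_series u =
     (\<lambda>n p. (if n = 0 then mat 1 else 0) + (if n \<ge> 0 then u 0 (- n - 1) p else 0))"

definition u0_wave ::
    "(int \<Rightarrow> int \<Rightarrow> ('a::comm_ring_1, 'r::finite) mat_fun) \<Rightarrow> ('a, 'r) z_fun \<Rightarrow> ('a, 'r) wave" where
  "u0_wave u \<rho> = {#(u0_series u, \<rho>)#}"

definition ubar0_wave ::
    "(int \<Rightarrow> int \<Rightarrow> ('a::comm_ring_1, 'r::finite) mat_fun) \<Rightarrow> ('a, 'r) z_fun \<Rightarrow> ('a, 'r) wave" where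
  "ubar0_wave u \<rho> = {#(ubar0_series u, \<rho>)#}"

end

theory Submission
  imports Defs
begin

text \<open>Differentiating the constraint at \<open>i = 0\<close> eliminates \<open>u\<^sub>1\<^sub>j\<close> from the evolution equation and gives
  \<open>\<partial>\<^sub>k u\<^sub>0\<^sub>j = \<partial>\<^sub>k\<^sub>-\<^sub>1 u\<^sub>0\<^sub>,\<^sub>j\<^sub>+\<^sub>1 + (\<partial>\<^sub>k\<^sub>-\<^sub>1 u\<^sub>0\<^sub>0) u\<^sub>0\<^sub>j\<close>. For both series \<open>W\<close> this says, coefficient by
  coefficient, that \<open>\<partial>\<^sub>k W = z \<partial>\<^sub>k\<^sub>-\<^sub>1 W + (\<partial>\<^sub>k\<^sub>-\<^sub>1 u\<^sub>0\<^sub>0) W\<close>, while the derivatives that fall on \<open>\<rho>\<close> match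
  after moving \<open>z\<close> across the product. Since smoothness depends only on the values on \<open>D\<close>, the
  products that occur inherit it from the equations they satisfy.\<close>

section \<open>Calculus of partial derivatives of matrix functions\<close>

text \<open>\<open>deriv\<close> takes an arbitrary value where no derivative exists, so
  \<open>partial\<close> alone makes no existence claim. Pairing existence with value lets the sum,
  sign and product rules deliver both at once.\<close>

definition has_partial_value ::
    "var \<Rightarrow> ('a::real_normed_field, 'r::finite) mat_fun \<Rightarrow> 'a point \<Rightarrow> 'a ^ 'r ^ 'r \<Rightarrow> bool" where
  "has_partial_value v f p M \<longleftrightarrow>
     (\<forall>i j. ((\<lambda>t. f (set_coord v t p) $ i $ j) has_field_derivative M $ i $ j) (at (coord v p)))"

lemma has_partial_value_partial:
  "has_partial v f p \<Longrightarrow> has_partial_value v f p (partial v f p)"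
  by (auto simp: has_partial_def has_partial_value_def partial_def
      DERIV_deriv_iff_field_differentiable)

lemma partial_eqI: "has_partial_value v f p M \<Longrightarrow> partial v f p = M"
  by (simp add: has_partial_value_def partial_def vec_eq_iff DERIV_imp_deriv)

lemma has_partialI: "has_partial_value v f p M \<Longrightarrow> has_partial v f p"
  by (auto simp: has_partial_value_def has_partial_def field_differentiable_def)

lemma set_coord_coord [simp]: "set_coord v (coord v p) p = p"
  by (cases p; cases v) auto

lemma has_partial_value_const: "has_partial_value v (\<lambda>_. C) p 0"
  by (simp add: has_partial_value_def)

lemma has_partial_value_add:
  "has_partial_value v f p M \<Longrightarrow> has_partial_value v g p N \<Longrightarrow>
    has_partial_value v (\<lambda>p. f p + g p) p (M + N)"
  by (auto simp: has_partial_value_def intro!: DERIV_add)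

lemma has_partial_value_minus:
  "has_partial_value v f p M \<Longrightarrow> has_partial_value v (\<lambda>p. - f p) p (- M)"
  by (auto simp: has_partial_value_def intro!: DERIV_minus)

text \<open>Matrix entries lie in a commutative field, so the scalar product rule applies to each
  summand of an entry. The order of the matrix factors is restored when the sums are read as matrix
  products.\<close>

lemma has_partial_value_mult:
  fixes f g :: "('a::real_normed_field, 'r::finite) mat_fun"
  assumes "has_partial_value v f p M" "has_partial_value v g p N"
  shows "has_partial_value v (\<lambda>p. f p ** g p) p (M ** g p + f p ** N)"
  unfolding has_partial_value_def
proof (intro allI)
  fix i j
  have "((\<lambda>t. \<Sum>k\<in>UNIV. f (set_coord v t p) $ i $ k * g (set_coord v t p) $ k $ j)
      has_field_derivative (\<Sum>k\<in>UNIV. M $ i $ k * g p $ k $ j + N $ k $ j * f p $ i $ k))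
      (at (coord v p))"
    using assms unfolding has_partial_value_def
    by (intro DERIV_sum) (rule DERIV_mult'[THEN DERIV_cong], auto)
  then show "((\<lambda>t. (f (set_coord v t p) ** g (set_coord v t p)) $ i $ j)
      has_field_derivative (M ** g p + f p ** N) $ i $ j) (at (coord v p))"
    by (simp add: matrix_matrix_mult_def sum.distrib mult.commute)
qed

text \<open>A partial derivative at \<open>p\<close> involves only points that differ from
  \<open>p\<close> in one coordinate, and \<open>coord_open\<close> keeps those near
  \<open>p\<close> inside \<open>D\<close>. Identities that hold only on \<open>D\<close> may
  therefore be differentiated.\<close>

lemma has_partial_value_cong:
  assumes "coord_open D" "p \<in> D" "\<And>p. p \<in> D \<Longrightarrow> f p = g p" "has_partial_value v f p M"
  shows "has_partial_value v g p M"
proof -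
  have "\<forall>\<^sub>F t in nhds (coord v p). set_coord v t p \<in> D"
    using assms(1,2) by (auto simp: coord_open_def)
  then have "\<forall>\<^sub>F t in nhds (coord v p). f (set_coord v t p) = g (set_coord v t p)"
    by eventually_elim (rule assms(3))
  then have "\<forall>\<^sub>F t in nhds (coord v p). f (set_coord v t p) $ i $ j = g (set_coord v t p) $ i $ j"
    for i j
    by eventually_elim simp
  then show ?thesis
    using assms(4) unfolding has_partial_value_def
    by (intro allI) (rule DERIV_cong_ev[OF HOL.refl _ HOL.refl, THEN iffD1], auto)
qed

section \<open>Closure properties of smoothness\<close>

lemma smooth_has_partial: "smooth D f \<Longrightarrow> p \<in> D \<Longrightarrow> has_partial v f p"
  unfolding smooth_def by (metis foldr_Nil id_apply)

lemma smooth_has_partial_value: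
  "smooth D f \<Longrightarrow> p \<in> D \<Longrightarrow> has_partial_value v f p (partial v f p)"
  by (simp add: has_partial_value_partial smooth_has_partial)

lemma smooth_partial:
  assumes "smooth D f"
  shows "smooth D (partial v f)"
  unfolding smooth_def
proof (intro allI ballI)
  fix vs w p
  assume "p \<in> D"
  then show "has_partial w (foldr partial vs (partial v f)) p"
    \<comment> \<open>\<open>foldr\<close> applies the last list element first, so the inner
      derivative \<open>v\<close> is appended at the end.\<close>
    using assms[unfolded smooth_def, rule_format, where vs = "vs @ [v]"] by simp
qed

text \<open>The list of iterated derivatives is dealt with here once, by induction. Later smoothness
  proofs only have to exhibit an invariant \<open>R\<close> that survives one
  differentiation.\<close>

lemma smooth_coinduct:
  assumes "R f"
    and "\<And>f v p. R f \<Longrightarrow> p \<in> D \<Longrightarrow> has_partial v f p"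
    and "\<And>f v. R f \<Longrightarrow> R (partial v f)"
  shows "smooth D f"
proof -
  have "R (foldr partial vs f)" for vs
    by (induction vs) (auto intro: assms)
  then show ?thesis
    unfolding smooth_def using assms(2) by blast
qed

text \<open>Off \<open>D\<close> nothing is known about \<open>g\<close>, so the invariant is
  agreement on \<open>D\<close> with some smooth function. Openness makes it stable under
  differentiation, with \<open>partial v f\<close> as the next witness.\<close>

lemma smooth_cong:
  assumes D: "coord_open D" and "smooth D f" "\<And>p. p \<in> D \<Longrightarrow> f p = g p"
  shows "smooth D g"
proof (rule smooth_coinduct[where R = "\<lambda>g. \<exists>f. smooth D f \<and> (\<forall>p\<in>D. f p = g p)"])
  show "\<exists>f. smooth D f \<and> (\<forall>p\<in>D. f p = g p)"
    by (intro exI[of _ f]) (simp add: assms)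
next
  fix g :: "('a, 'b) mat_fun" and v
  assume "\<exists>f. smooth D f \<and> (\<forall>p\<in>D. f p = g p)"
  then obtain f where f: "smooth D f" and g: "\<And>p. p \<in> D \<Longrightarrow> f p = g p"
    by blast
  have *: "has_partial_value v g p (partial v f p)" if "p \<in> D" for p
    using has_partial_value_cong[OF D that, of f g v] g that f
    by (blast intro: smooth_has_partial_value)
  then show "has_partial v g p" if "p \<in> D" for p
    using that has_partialI by blast
  show "\<exists>f. smooth D f \<and> (\<forall>p\<in>D. f p = partial v g p)"
    by (intro exI[of _ "partial v f"]) (simp add: f smooth_partial partial_eqI[OF *])
qed

lemma partial_const [simp]: "partial v (\<lambda>_. C) p = 0"
  by (rule partial_eqI) (rule has_partial_value_const)

lemma smooth_const: "smooth D (\<lambda>_. C)"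
proof (rule smooth_coinduct[where R = "\<lambda>f. \<exists>C. f = (\<lambda>_. C)"])
  fix f :: "('a, 'b) mat_fun" and v
  assume "\<exists>C. f = (\<lambda>_. C)"
  then show "\<exists>C. partial v f = (\<lambda>_. C)"
    by (intro exI[of _ 0]) auto
qed (auto intro: has_partialI has_partial_value_const)

text \<open>The invariant asks for a decomposition on \<open>D\<close> only: off \<open>D\<close>
  derivatives need not exist, and then \<open>partial\<close> need not be additive.\<close>

lemma smooth_add:
  assumes D: "coord_open D" and "smooth D f" "smooth D g"
  shows "smooth D (\<lambda>p. f p + g p)"
proof (rule smooth_coinduct[where
      R = "\<lambda>h. \<exists>f g. smooth D f \<and> smooth D g \<and> (\<forall>p\<in>D. f p + g p = h p)"])
  show "\<exists>f' g'. smooth D f' \<and> smooth D g' \<and> (\<forall>p\<in>D. f' p + g' p = f p + g p)"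
    by (intro exI[of _ f] exI[of _ g]) (simp add: assms)
next
  fix h :: "('a, 'b) mat_fun" and v
  assume "\<exists>f g. smooth D f \<and> smooth D g \<and> (\<forall>p\<in>D. f p + g p = h p)"
  then obtain f g where fg: "smooth D f" "smooth D g" and h: "\<And>p. p \<in> D \<Longrightarrow> f p + g p = h p"
    by blast
  have *: "has_partial_value v h p (partial v f p + partial v g p)" if "p \<in> D" for p
    using has_partial_value_cong[OF D that, of "\<lambda>p. f p + g p" h v] h that fg
    by (blast intro: has_partial_value_add smooth_has_partial_value)
  then show "has_partial v h p" if "p \<in> D" for p
    using that has_partialI by blast
  show "\<exists>f g. smooth D f \<and> smooth D g \<and> (\<forall>p\<in>D. f p + g p = partial v h p)"
    by (intro exI[of _ "partial v f"] exI[of _ "partial v g"])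
      (simp add: fg smooth_partial partial_eqI[OF *])
qed

lemma smooth_minus:
  assumes D: "coord_open D" and "smooth D f"
  shows "smooth D (\<lambda>p. - f p)"
proof (rule smooth_coinduct[where R = "\<lambda>h. \<exists>f. smooth D f \<and> (\<forall>p\<in>D. - f p = h p)"])
  show "\<exists>f'. smooth D f' \<and> (\<forall>p\<in>D. - f' p = - f p)"
    by (intro exI[of _ f]) (simp add: assms)
next
  fix h :: "('a, 'b) mat_fun" and v
  assume "\<exists>f. smooth D f \<and> (\<forall>p\<in>D. - f p = h p)"
  then obtain f where f: "smooth D f" and h: "\<And>p. p \<in> D \<Longrightarrow> - f p = h p"
    by blast
  have *: "has_partial_value v h p (- partial v f p)" if "p \<in> D" for p
    using has_partial_value_cong[OF D that, of "\<lambda>p. - f p" h v] h that f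
    by (blast intro: has_partial_value_minus smooth_has_partial_value)
  then show "has_partial v h p" if "p \<in> D" for p
    using that has_partialI by blast
  show "\<exists>f. smooth D f \<and> (\<forall>p\<in>D. - f p = partial v h p)"
    by (intro exI[of _ "partial v f"]) (simp add: f smooth_partial partial_eqI[OF *])
qed

lemma smooth_diff:
  assumes "coord_open D" "smooth D f" "smooth D g"
  shows "smooth D (\<lambda>p. f p - g p)"
  using smooth_add[OF assms(1,2) smooth_minus[OF assms(1,3)]] by simp

text \<open>Vanishing on \<open>D\<close> passes to derivatives, which keeps the support bound of a
  Laurent series valid after differentiation.\<close>

lemma partial_zero_on:
  assumes "coord_open D" "p \<in> D" "\<And>p. p \<in> D \<Longrightarrow> f p = 0"
  shows "partial v f p = 0"
  using has_partial_value_cong[OF assms(1,2) _ has_partial_value_const, of 0 f] assms(3)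
  by (auto intro: partial_eqI)

lemma matrix_mult_uminus_right:
  fixes A B :: "'a::comm_ring_1 ^ 'r ^ 'r"
  shows "A ** (- B) = - (A ** B)"
  by (simp add: matrix_matrix_mult_def vec_eq_iff sum_negf)

section \<open>From coefficient identities to equality of wave expressions\<close>

lemma wave_eq_add_both:
  assumes "wave_eq L Z D P Q" "wave_eq L Z D P' Q'"
  shows "wave_eq L Z D (P + P') (Q + Q')"
proof (rule wave_eq.trans)
  show "wave_eq L Z D (P + P') (Q + P')"
    by (rule wave_eq.add[OF assms(1)])
  show "wave_eq L Z D (Q + P') (Q + Q')"
    using wave_eq.add[OF assms(2), of Q] by (simp add: add.commute)
qed

text \<open>The Leibniz rule splits each side into terms that differentiate \<open>W\<close> and
  terms that differentiate \<open>\<rho>\<close>. The former, together with the \<open>A\<close>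
  term, match by \<open>coeff\<close>; the latter match by moving \<open>z\<close> across the
  product. Most of the work is to show that every series and factor involved is admissible for the
  generators of \<open>wave_eq\<close>.\<close>

lemma wave_eq_of_coefficients:
  fixes W :: "('a::real_normed_field, 'r::finite) laurent" and L :: "('a, 'r) laurent set"
  assumes D: "coord_open D"
    and L: "L = laurent_neg D \<or> L = laurent_pos D"
    and W: "W \<in> L"
    and \<rho>: "\<And>z. z \<in> Z \<Longrightarrow> smooth D (\<rho> z)"
    and \<rho>_eq: "\<And>z p. z \<in> Z \<Longrightarrow> p \<in> D \<Longrightarrow> partial v (\<rho> z) p = mat z ** partial w (\<rho> z) p"
    and coeff: "\<And>n p. p \<in> D \<Longrightarrow>
      partial v (W n) p = partial w (W (n - 1)) p + A p ** W n p"
  shows "wave_eq L Z D (wave_partial v {#(W, \<rho>)#})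
    (wave_z (wave_partial w {#(W, \<rho>)#}) + wave_left A {#(W, \<rho>)#})"
proof -
  let ?S = "\<lambda>n p. laurent_z (laurent_partial w W) n p + laurent_left A W n p"
  \<comment> \<open>The sign \<open>s\<close> is 1 for \<open>laurent_neg\<close> and -1 for
    \<open>laurent_pos\<close>; it turns both support conditions into one, so that closure of
    \<open>L\<close> is proved once for both spaces.\<close>
  obtain s :: int where
    mem: "\<And>V. V \<in> L \<longleftrightarrow> (\<forall>n. smooth D (V n)) \<and> (\<exists>N. \<forall>n. s * n > N \<longrightarrow> (\<forall>p\<in>D. V n p = 0))"
    using L
  proof
    assume "L = laurent_neg D"
    then show thesis
      using that[of 1] by (simp add: laurent_neg_def)
  next
    assume "L = laurent_pos D"
    moreover have "(\<exists>N. \<forall>n<N. P n) \<longleftrightarrow> (\<exists>N. \<forall>n. - 1 * n > N \<longrightarrow> P n)" for P :: "int \<Rightarrow> bool"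
      by (metis equation_minus_iff minus_less_iff mult_minus1)
    ultimately show thesis
      using that[of "- 1"] by (simp add: laurent_pos_def)
  qed
  have smooth_W: "smooth D (W n)" for n
    using W by (simp add: mem)
  have partial_L: "laurent_partial v W \<in> L" for v
  proof -
    obtain N where "\<And>n p. s * n > N \<Longrightarrow> p \<in> D \<Longrightarrow> W n p = 0"
      using W unfolding mem by blast
    then have "\<forall>n. s * n > N \<longrightarrow> (\<forall>p\<in>D. laurent_partial v W n p = 0)"
      by (auto simp: laurent_partial_def intro: partial_zero_on[OF D])
    then show ?thesis
      using smooth_W by (auto simp: mem laurent_partial_def intro: smooth_partial)
  qed
  have z_L: "laurent_z V \<in> L" if "V \<in> L" for V
  proof -
    obtain N where "\<And>n p. s * n > N \<Longrightarrow> p \<in> D \<Longrightarrow> V n p = 0"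
      using \<open>V \<in> L\<close> unfolding mem by blast
    \<comment> \<open>Multiplication by \<open>z\<close> shifts the index by one, which moves the
      bound on \<open>s * n\<close> by \<open>s\<close>.\<close>
    then have "\<forall>n. s * n > N + s \<longrightarrow> (\<forall>p\<in>D. laurent_z V n p = 0)"
      by (simp add: laurent_z_def algebra_simps)
    then show ?thesis
      using that by (auto simp: mem laurent_z_def)
  qed
  \<comment> \<open>On \<open>D\<close>, \<open>coeff\<close> exhibits this product as a difference
    of derivatives of coefficients of \<open>W\<close>.\<close>
  have "smooth D (\<lambda>p. A p ** W n p)" for n
    by (rule smooth_cong[OF D smooth_diff[OF D smooth_partial[OF smooth_W] smooth_partial[OF smooth_W],
          of v n w "n - 1"]])
      (simp add: coeff)
  moreover have "\<exists>N. \<forall>n. s * n > N \<longrightarrow> (\<forall>p\<in>D. A p ** W n p = 0)"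
  proof -
    obtain N where "\<And>n p. s * n > N \<Longrightarrow> p \<in> D \<Longrightarrow> W n p = 0"
      using W unfolding mem by blast
    then have "\<forall>n. s * n > N \<longrightarrow> (\<forall>p\<in>D. A p ** W n p = 0)"
      by simp
    then show ?thesis ..
  qed
  ultimately have left_L: "laurent_left A W \<in> L"
    by (simp add: mem laurent_left_def)
  have S_eq: "laurent_partial v W n p = ?S n p" if "p \<in> D" for n p
    using coeff[OF that] by (simp add: laurent_partial_def laurent_z_def laurent_left_def)
  \<comment> \<open>On \<open>D\<close> the sum \<open>?S\<close> is the derivative of
    \<open>W\<close> along \<open>v\<close>, from which it takes both smoothness and support
    bound.\<close>
  have "smooth D (?S n)" for n
    by (rule smooth_cong[OF D smooth_partial[OF smooth_W, of v n]])
      (use S_eq in \<open>simp add: laurent_partial_def\<close>)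
  then have S_L: "?S \<in> L"
    using partial_L[of v] by (simp add: mem S_eq)
  have smooth_\<rho>: "\<rho> \<in> smooth_z_fun Z D" "(\<lambda>z. partial v (\<rho> z)) \<in> smooth_z_fun Z D" for v
    using \<rho> by (auto simp: smooth_z_fun_def intro: smooth_partial)
  \<comment> \<open>By \<open>\<rho>_eq\<close> this factor agrees on \<open>D\<close> with a
    derivative of \<open>\<rho> z\<close>, hence is smooth.\<close>
  have "(\<lambda>z p. mat z ** partial w (\<rho> z) p) \<in> smooth_z_fun Z D"
    unfolding smooth_z_fun_def
    using smooth_cong[OF D smooth_partial[OF \<rho>], of _ v] \<rho>_eq by fastforce
  \<comment> \<open>Both terms that differentiate \<open>\<rho>\<close> are reduced to the common
    form with \<open>W\<close> on the left and \<open>z\<close> inside the right factor.\<close>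
  then have "wave_eq L Z D {#(W, \<lambda>z. partial v (\<rho> z))#}
      {#(W, \<lambda>z p. mat z ** partial w (\<rho> z) p)#}"
    using W smooth_\<rho> \<rho>_eq by (intro wave_eq.agree) auto
  moreover have "wave_eq L Z D {#(laurent_z W, \<lambda>z. partial w (\<rho> z))#}
      {#(W, \<lambda>z p. mat z ** partial w (\<rho> z) p)#}"
    using W smooth_\<rho> by (intro wave_eq.move_z)
  ultimately have B: "wave_eq L Z D {#(W, \<lambda>z. partial v (\<rho> z))#}
      {#(laurent_z W, \<lambda>z. partial w (\<rho> z))#}"
    by (blast intro: wave_eq.trans wave_eq.sym)
  have "wave_eq L Z D {#(laurent_partial v W, \<rho>)#} {#(?S, \<rho>)#}"
    using partial_L S_L smooth_\<rho> S_eq by (intro wave_eq.agree) auto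
  moreover have "wave_eq L Z D {#(?S, \<rho>)#}
      {#(laurent_z (laurent_partial w W), \<rho>), (laurent_left A W, \<rho>)#}"
    by (intro wave_eq.add_left z_L partial_L left_L smooth_\<rho>)
  ultimately have "wave_eq L Z D {#(laurent_partial v W, \<rho>)#}
      {#(laurent_z (laurent_partial w W), \<rho>), (laurent_left A W, \<rho>)#}"
    by (rule wave_eq.trans)
  from wave_eq_add_both[OF this B] show ?thesis
    by (simp add: wave_partial_def wave_z_def wave_left_def add_mset_commute)
qed

section \<open>Recursions for the coefficients of the two series\<close>

lemma partial_u0:
  fixes u :: "int \<Rightarrow> int \<Rightarrow> ('a::real_normed_field, 'r::finite) mat_fun"
  assumes D: "coord_open D"
    and u: "\<And>i j. smooth D (u i j)"
    and evolution: "\<And>i j p. p \<in> D \<Longrightarrow>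
      partial v (u i j) p = partial w (u (i + 1) j) p - u i 0 p ** partial w (u 0 j) p"
    and cons: "\<And>i j p. p \<in> D \<Longrightarrow> u (i + 1) j p - u i (j + 1) p - u i 0 p ** u 0 j p = 0"
    and p: "p \<in> D"
  shows "partial v (u 0 j) p = partial w (u 0 (j + 1)) p + partial w (u 0 0) p ** u 0 j p"
proof -
  \<comment> \<open>The constraint holds on all of \<open>D\<close>, not just at \<open>p\<close>,
    so it can be differentiated in the next step.\<close>
  have u1: "u 0 (j + 1) p + u 0 0 p ** u 0 j p = u 1 j p" if "p \<in> D" for p
    using cons[OF that, of 0 j] by (simp add: algebra_simps)
  have "has_partial_value w (\<lambda>p. u 0 (j + 1) p + u 0 0 p ** u 0 j p) p
      (partial w (u 0 (j + 1)) p
        + (partial w (u 0 0) p ** u 0 j p + u 0 0 p ** partial w (u 0 j) p))"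
    by (intro has_partial_value_add has_partial_value_mult smooth_has_partial_value[OF u p])
  then have "partial w (u 1 j) p = partial w (u 0 (j + 1)) p
      + (partial w (u 0 0) p ** u 0 j p + u 0 0 p ** partial w (u 0 j) p)"
    by (intro partial_eqI) (rule has_partial_value_cong[OF D p u1])
  \<comment> \<open>The summand \<open>u 0 0 p ** partial w (u 0 j) p\<close> from the product rule
    cancels the quadratic term of the evolution equation at \<open>i = 0\<close>.\<close>
  then show ?thesis
    using evolution[OF p, of 0 j] by simp
qed

lemma u0_series_coefficients:
  fixes u :: "int \<Rightarrow> int \<Rightarrow> ('a::real_normed_field, 'r::finite) mat_fun"
  assumes u: "\<And>i j. smooth D (u i j)"
    and step: "\<And>j p. p \<in> D \<Longrightarrow>
      partial v (u 0 j) p = partial w (u 0 (j + 1)) p + partial w (u 0 0) p ** u 0 j p"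
    and p: "p \<in> D"
  shows "partial v (u0_series u n) p =
    partial w (u0_series u (n - 1)) p + partial w (u 0 0) p ** u0_series u n p"
proof -
  have neg: "partial v (u0_series u n) p = - partial v (u 0 (- n - 1)) p" if "n < 0" for v n
    using that has_partial_value_minus[OF smooth_has_partial_value[OF u p]]
    by (auto simp: u0_series_def intro: partial_eqI)
  have nonneg: "partial v (u0_series u n) p = 0" if "n \<ge> 0" for v n
    using that by (simp add: u0_series_def)
  consider "n < 0" | "n = 0" | "n > 0" by linarith
  then show ?thesis
  proof cases
    \<comment> \<open>With \<open>j = - n - 1\<close>, the coefficient at \<open>n - 1\<close> is
      \<open>- u 0 (j + 1)\<close>, so this is the negated recursion.\<close>
    case 1
    then show ?thesis
      using step[OF p, of "- n - 1"] neg[of n v] neg[of "n - 1" w]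
      by (simp add: u0_series_def matrix_mult_uminus_right)
  next
    \<comment> \<open>The coefficient at \<open>n = 0\<close> is the constant unit matrix. The
      shifted coefficient at -1 is \<open>- u 0 0\<close>, and its derivative cancels
      \<open>partial w (u 0 0) p ** mat 1\<close>.\<close>
    case 2
    then show ?thesis
      using neg[of "- 1" w] nonneg[of 0 v] by (simp add: u0_series_def)
  next
    case 3
    then show ?thesis
      using nonneg[of n v] nonneg[of "n - 1" w] by (simp add: u0_series_def)
  qed
qed

lemma ubar0_series_coefficients:
  fixes u :: "int \<Rightarrow> int \<Rightarrow> ('a::real_normed_field, 'r::finite) mat_fun"
  assumes u: "\<And>i j. smooth D (u i j)"
    and step: "\<And>j p. p \<in> D \<Longrightarrow>
      partial v (u 0 j) p = partial w (u 0 (j + 1)) p + partial w (u 0 0) p ** u 0 j p"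
    and p: "p \<in> D"
  shows "partial v (ubar0_series u n) p =
    partial w (ubar0_series u (n - 1)) p + partial w (u 0 0) p ** ubar0_series u n p"
proof -
  have nonneg: "partial v (ubar0_series u n) p = partial v (u 0 (- n - 1)) p" if "n \<ge> 0" for v n
    using that has_partial_value_add[OF has_partial_value_const[of v "if n = 0 then mat 1 else 0" p]
        smooth_has_partial_value[OF u p, of v 0 "- n - 1"]]
    by (auto simp: ubar0_series_def intro: partial_eqI)
  have neg: "partial v (ubar0_series u n) p = 0" if "n < 0" for v n
    using that by (simp add: ubar0_series_def)
  consider "n < 0" | "n = 0" | "n > 0" by linarith
  then show ?thesis
  proof cases
    case 1
    then show ?thesis
      using neg[of n v] neg[of "n - 1" w] by (simp add: ubar0_series_def)
  next
    \<comment> \<open>The shifted coefficient at -1 is zero. At \<open>j = -1\<close> the recursion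
      has the extra term \<open>partial w (u 0 0) p\<close>, which is exactly the contribution of
      the unit matrix in the coefficient at 0.\<close>
    case 2
    then show ?thesis
      using step[OF p, of "- 1"] nonneg[of 0 v] neg[of "- 1" w]
      by (simp add: ubar0_series_def matrix_add_ldistrib)
  next
    case 3
    then show ?thesis
      using step[OF p, of "- n - 1"] nonneg[of n v] nonneg[of "n - 1" w]
      by (simp add: ubar0_series_def)
  qed
qed

section \<open>Membership of the series in the Laurent spaces\<close>

lemma u0_series_in_laurent_neg:
  assumes "coord_open D" "\<And>i j. smooth D (u i j)"
  shows "u0_series u \<in> laurent_neg D"
proof -
  have "smooth D (u0_series u n)" for n
    using smooth_minus[OF assms(1) assms(2)[of 0 "- n - 1"]] smooth_const[of D "mat 1"]
      smooth_const[of D 0]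
    by (cases "n < 0"; cases "n = 0") (simp_all add: u0_series_def)
  moreover have "\<forall>n>0. \<forall>p\<in>D. u0_series u n p = 0"
    by (simp add: u0_series_def)
  ultimately show ?thesis
    unfolding laurent_neg_def by blast
qed

lemma ubar0_series_in_laurent_pos:
  assumes "coord_open D" "\<And>i j. smooth D (u i j)"
  shows "ubar0_series u \<in> laurent_pos D"
proof -
  have "smooth D (ubar0_series u n)" for n
    using smooth_add[OF assms(1) smooth_const assms(2)[of 0 "- n - 1"]]
      smooth_const[of D 0]
    by (cases "n < 0") (simp_all add: ubar0_series_def)
  moreover have "\<forall>n<0. \<forall>p\<in>D. ubar0_series u n p = 0"
    by (simp add: ubar0_series_def)
  ultimately show ?thesis
    unfolding laurent_pos_def by blast
qed

section \<open>The auxiliary linear equations\<close>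

text \<open>Only the relation between the two derivations enters, so \<open>v\<close> and
  \<open>w\<close> are left arbitrary. The pairs \<open>Var_x k\<close>,
  \<open>Var_x (k - 1)\<close> and \<open>Var_y k\<close>, \<open>Var_y (k - 1)\<close> then give
  all four families.\<close>

lemma wave_equations:
  fixes u :: "int \<Rightarrow> int \<Rightarrow> ('a::real_normed_field, 'r::finite) mat_fun"
  assumes D: "coord_open D"
    and u: "\<And>i j. smooth D (u i j)"
    and evolution: "\<And>i j p. p \<in> D \<Longrightarrow>
      partial v (u i j) p = partial w (u (i + 1) j) p - u i 0 p ** partial w (u 0 j) p"
    and cons: "\<And>i j p. p \<in> D \<Longrightarrow> u (i + 1) j p - u i (j + 1) p - u i 0 p ** u 0 j p = 0"
    and \<rho>: "\<And>z. z \<in> Z \<Longrightarrow> smooth D (\<rho> z)"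
    and \<rho>_eq: "\<And>z p. z \<in> Z \<Longrightarrow> p \<in> D \<Longrightarrow> partial v (\<rho> z) p - mat z ** partial w (\<rho> z) p = 0"
  shows "wave_eq (laurent_neg D) Z D (wave_partial v (u0_wave u \<rho>))
      (wave_z (wave_partial w (u0_wave u \<rho>)) + wave_left (partial w (u 0 0)) (u0_wave u \<rho>))"
    and "wave_eq (laurent_pos D) Z D (wave_partial v (ubar0_wave u \<rho>))
      (wave_z (wave_partial w (ubar0_wave u \<rho>)) + wave_left (partial w (u 0 0)) (ubar0_wave u \<rho>))"
proof -
  have step: "partial v (u 0 j) p = partial w (u 0 (j + 1)) p + partial w (u 0 0) p ** u 0 j p"
    if "p \<in> D" for j p
    using D u evolution cons that by (rule partial_u0)
  have \<rho>_eq': "partial v (\<rho> z) p = mat z ** partial w (\<rho> z) p" if "z \<in> Z" "p \<in> D" for z p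
    using \<rho>_eq[OF that] by simp
  show "wave_eq (laurent_neg D) Z D (wave_partial v (u0_wave u \<rho>))
      (wave_z (wave_partial w (u0_wave u \<rho>)) + wave_left (partial w (u 0 0)) (u0_wave u \<rho>))"
    unfolding u0_wave_def
  proof (rule wave_eq_of_coefficients[OF D _ u0_series_in_laurent_neg[OF D u] \<rho> \<rho>_eq'])
    show "partial v (u0_series u n) p =
        partial w (u0_series u (n - 1)) p + partial w (u 0 0) p ** u0_series u n p"
      if "p \<in> D" for n p
      using u step that by (rule u0_series_coefficients)
  qed simp_all
  show "wave_eq (laurent_pos D) Z D (wave_partial v (ubar0_wave u \<rho>))
      (wave_z (wave_partial w (ubar0_wave u \<rho>)) + wave_left (partial w (u 0 0)) (ubar0_wave u \<rho>))"
    unfolding ubar0_wave_def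
  proof (rule wave_eq_of_coefficients[OF D _ ubar0_series_in_laurent_pos[OF D u] \<rho> \<rho>_eq'])
    show "partial v (ubar0_series u n) p =
        partial w (ubar0_series u (n - 1)) p + partial w (u 0 0) p ** ubar0_series u n p"
      if "p \<in> D" for n p
      using u step that by (rule ubar0_series_coefficients)
  qed simp_all
qed

theorem mainTheorem17:
  fixes D :: "'a::real_normed_field point set"
    and Z :: "'a set"
    and u :: "int \<Rightarrow> int \<Rightarrow> ('a, 'r::finite) mat_fun"
    and \<rho> :: "('a, 'r) z_fun"
  assumes "CARD('r) > 1"
    and "coord_open D"
    and "\<And>i j. smooth D (u i j)"
    and "\<And>i j k p. k \<ge> 1 \<Longrightarrow> p \<in> D \<Longrightarrow>
      partial (Var_x k) (u i j) p =
        partial (Var_x (k - 1)) (u (i + 1) j) p - u i 0 p ** partial (Var_x (k - 1)) (u 0 j) p"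
    and "\<And>i j k p. k \<ge> 1 \<Longrightarrow> p \<in> D \<Longrightarrow>
      partial (Var_y k) (u i j) p =
        partial (Var_y (k - 1)) (u (i + 1) j) p - u i 0 p ** partial (Var_y (k - 1)) (u 0 j) p"
    and "\<And>i j p. p \<in> D \<Longrightarrow> u (i + 1) j p - u i (j + 1) p - u i 0 p ** u 0 j p = 0"
    and "\<And>z. z \<in> Z \<Longrightarrow> smooth D (\<rho> z)"
    and "\<And>z p. z \<in> Z \<Longrightarrow> p \<in> D \<Longrightarrow> invertible (\<rho> z p)"
    and "\<And>k z p. k \<ge> 1 \<Longrightarrow> z \<in> Z \<Longrightarrow> p \<in> D \<Longrightarrow>
      partial (Var_x k) (\<rho> z) p - mat z ** partial (Var_x (k - 1)) (\<rho> z) p = 0"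
    and "\<And>k z p. k \<ge> 1 \<Longrightarrow> z \<in> Z \<Longrightarrow> p \<in> D \<Longrightarrow>
      partial (Var_y k) (\<rho> z) p - mat z ** partial (Var_y (k - 1)) (\<rho> z) p = 0"
  shows "\<forall>k\<ge>1.
      wave_eq (laurent_neg D) Z D (wave_partial (Var_x k) (u0_wave u \<rho>))
        (wave_z (wave_partial (Var_x (k - 1)) (u0_wave u \<rho>))
          + wave_left (partial (Var_x (k - 1)) (u 0 0)) (u0_wave u \<rho>))
    \<and> wave_eq (laurent_neg D) Z D (wave_partial (Var_y k) (u0_wave u \<rho>))
        (wave_z (wave_partial (Var_y (k - 1)) (u0_wave u \<rho>))
          + wave_left (partial (Var_y (k - 1)) (u 0 0)) (u0_wave u \<rho>))
    \<and> wave_eq (laurent_pos D) Z D (wave_partial (Var_x k) (ubar0_wave u \<rho>))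
        (wave_z (wave_partial (Var_x (k - 1)) (ubar0_wave u \<rho>))
          + wave_left (partial (Var_x (k - 1)) (u 0 0)) (ubar0_wave u \<rho>))
    \<and> wave_eq (laurent_pos D) Z D (wave_partial (Var_y k) (ubar0_wave u \<rho>))
        (wave_z (wave_partial (Var_y (k - 1)) (ubar0_wave u \<rho>))
          + wave_left (partial (Var_y (k - 1)) (u 0 0)) (ubar0_wave u \<rho>))"
  by (intro allI impI conjI wave_equations assms(2-7,9,10))

end
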